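(* Let $(\mathfrak m,V,\omega,B_\mu)$ be a special symplectic representation over $k$ and let $\lambda\in k^*$. Define $\alpha:\widehat{\mathcal O_\lambda}\to V_\lambda$ and $\beta:Z_\lambda^{gen}\to V\oplus k$ by $$\alpha(P,z)=\tfrac12\Bigl(P+\tfrac1{z\sqrt\lambda}\Psi(P)\Bigr)\quad\forall (P,z)\in\widehat{\mathcal O_\lambda},\qquad \beta(v)=(v+\bar v,\ 3h(v))\quad\forall v\in Z_\lambda^{gen}.$$ Then: (i) $\alpha(\sigma(\hat P))=\overline{\alpha(\hat P)}$ for all $\hat P\in\widehat{\mathcal O_\lambda}$. (ii) $\alpha$ and $\beta$ commute with the natural $k^*$-actions. (iii) $\alpha$ takes values in $Z_\lambda^{gen}$ and $\beta\circ\alpha=\mathrm{Id}_{\widehat{\mathcal O_\lambda}}$. (iv) $\beta$ takes values in $\widehat{\mathcal O_\lambda}$ and $\alpha\circ\beta=\mathrm{Id}_{Z_\lambda^{gen}}$. (v) $\alpha^*$ maps $R(Z_\lambda^{gen})$ to $R(\widehat{\mathcal O_\lambda})$. (vi) $\beta^*$ maps $R(\widehat{\mathcal O_\lambda})$ to $R(Z_\lambda^{gen})$.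
   Context: $k$ is a field of characteristic not $2$ or $3$; $V$ is finite-dimensional. A special symplectic representation (SSR) $(\mathfrak m,V,\omega,B_\mu)$ over $k$ is a faithful representation of a Lie algebra $\mathfrak m$ over $k$ on a symplectic vector space $(V,\omega)$ ($\omega$ a nondegenerate alternating bilinear form), together with an $\mathfrak m$-equivariant symmetric bilinear map $B_\mu:V\times V\to\mathfrak m$ (equivariance: $[m,B_\mu(A,B)]=B_\mu(m\cdot A,B)+B_\mu(A,m\cdot B)$), such that for all $m\in\mathfrak m$ and $A,B,C\in V$: $$\omega(m\cdot A,B)+\omega(A,m\cdot B)=0,$$ $$2B_\mu(A,B)\cdot C-2B_\mu(A,C)\cdot B=2\omega(B,C)A-\omega(A,B)C+\omega(A,C)B.$$ Covariants: $\mu(A)=B_\mu(A,A)\in\mathfrak m$, $\Psi(A)=\mu(A)\cdot A\in V$, $Q(A)=\frac32\,\omega(A,\Psi(A))\in k$. Algebra $A_\lambda$: $A_\lambda=k[x]/\langle x^2-\lambda\rangle$, with $\sqrt\lambda$ the class of $x$ and conjugation $\bar{\ }:A_\lambda\to A_\lambda$ induced by $x\mapsto -x$ (so $A_\lambda\cong k\times k$ if $\lambda$ is a square, and a quadratic field extension otherwise). Its fixed point set is identified with $k$. Put $V_\lambda=V\otimes_kA_\lambda$, on which conjugation acts through the second factor with fixed point set $V$. Let $(\mathfrak m_\lambda,V_\lambda,\omega_\lambda,B_\lambda)$ be the base extension of the SSR to $A_\lambda$, with $\mu_\lambda(v)=B_\lambda(v,v)$, and let $h:V_\lambda\to k$ be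 $h(v)=\frac1{\sqrt\lambda}\omega_\lambda(\bar v,v)$. The variety $\widehat{\mathcal O_\lambda}$: let $\hat V=V\oplus k$, $\sigma(P,z)=(P,-z)$, $\hat Q(P,z)=Q(P)$, $H(P,z)=z$, and $$\widehat{\mathcal O_\lambda}=\{\hat P\in\hat V:\hat Q(\hat P)\neq0\text{ and }\hat Q(\hat P)=\lambda H(\hat P)^2\}.$$ $R(\widehat{\mathcal O_\lambda})$ is the ring of $k$-valued functions on $\widehat{\mathcal O_\lambda}$ which are restrictions of elements of $S(\hat V^* )[\frac1{\hat Q}]$, where $S(\hat V^* )$ is the ring of polynomial functions on $\hat V$. The variety $Z_\lambda^{gen}$: $$Z_\lambda^{gen}=\{v\in V_\lambda: h(v)\neq0\text{ and }\mu_\lambda(v)=0\}.$$ $R(Z_\lambda^{gen})$ is the ring of $k$-valued functions on $Z_\lambda^{gen}$ which are restrictions of elements of $S(V_\lambda^* )[\frac1h]$, where $S(V_\lambda^* )$ is the ring of $k$-valued $k$-polynomial functions on $V_\lambda$. Natural $k^*$-actions: $a\cdot(P,z)=(aP,a^2z)$ on $\hat V$ (preserving $\widehat{\mathcal O_\lambda}$), and scalar multiplication on $V_\lambda$ (preserving $Z_\lambda^{gen}$). $\alpha^*$, $\beta^*$ denote pullback of functions, $\alpha^*f=f\circ\alpha$, $\beta^*f=f\circ\beta$. *)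

theory Defs
  imports
    "HOL-Algebra.QuotRing"
    "HOL-Computational_Algebra.Polynomial"
    "HOL-Library.Product_Plus"
    "HOL-Library.FuncSet"
begin

section \<open>Special symplectic representations\<close>

definition bilin ::
  "('k::field \<Rightarrow> 'u::ab_group_add \<Rightarrow> 'u) \<Rightarrow> ('k \<Rightarrow> 'v::ab_group_add \<Rightarrow> 'v) \<Rightarrow>
   ('k \<Rightarrow> 'w::ab_group_add \<Rightarrow> 'w) \<Rightarrow> ('u \<Rightarrow> 'v \<Rightarrow> 'w) \<Rightarrow> bool"
  where "bilin s1 s2 s3 b \<longleftrightarrow>
    (\<forall>x. Vector_Spaces.linear s2 s3 (b x)) \<and> (\<forall>y. Vector_Spaces.linear s1 s3 (\<lambda>x. b x y))"

locale lie_algebra = vector_space scM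
  for scM :: "'k::field \<Rightarrow> 'm::ab_group_add \<Rightarrow> 'm" +
  fixes brk :: "'m \<Rightarrow> 'm \<Rightarrow> 'm"
  assumes brk_bilin: "bilin scM scM scM brk"
    and brk_alt: "brk x x = 0"
    and brk_jacobi: "brk x (brk y z) + brk y (brk z x) + brk z (brk x y) = 0"

locale faithful_lie_rep = lie_algebra scM brk + V: vector_space scV
  for scM :: "'k::field \<Rightarrow> 'm::ab_group_add \<Rightarrow> 'm"
    and brk :: "'m \<Rightarrow> 'm \<Rightarrow> 'm"
    and scV :: "'k \<Rightarrow> 'v::ab_group_add \<Rightarrow> 'v" +
  fixes act :: "'m \<Rightarrow> 'v \<Rightarrow> 'v"
  assumes act_bilin: "bilin scM scV scV act"
    and act_brk: "act (brk x y) A = act x (act y A) - act y (act x A)"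
    and act_faithful: "inj act"

locale symplectic_space = vector_space scV
  for scV :: "'k::field \<Rightarrow> 'v::ab_group_add \<Rightarrow> 'v" +
  fixes om :: "'v \<Rightarrow> 'v \<Rightarrow> 'k"
  assumes om_bilin: "bilin scV scV (*) om"
    and om_alt: "om A A = 0"
    and om_nondegenerate: "(\<And>B. om A B = 0) \<Longrightarrow> A = 0"

locale special_symplectic_rep =
  faithful_lie_rep scM brk scV act + symplectic_space scV om
  for scM :: "'k::field \<Rightarrow> 'm::ab_group_add \<Rightarrow> 'm"
    and brk :: "'m \<Rightarrow> 'm \<Rightarrow> 'm"
    and scV :: "'k \<Rightarrow> 'v::ab_group_add \<Rightarrow> 'v"
    and act :: "'m \<Rightarrow> 'v \<Rightarrow> 'v"
    and om :: "'v \<Rightarrow> 'v \<Rightarrow> 'k" +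
  fixes Bmu :: "'v \<Rightarrow> 'v \<Rightarrow> 'm"
  assumes finite_dim: "\<exists>Basis. finite_dimensional_vector_space scV Basis"
    and Bmu_bilin: "bilin scV scV scM Bmu"
    and Bmu_sym: "Bmu A B = Bmu B A"
    and Bmu_equivariant: "brk m (Bmu A B) = Bmu (act m A) B + Bmu A (act m B)"
    and om_invariant: "om (act m A) B + om A (act m B) = 0"
    and Bmu_identity:
      "scV 2 (act (Bmu A B) C) - scV 2 (act (Bmu A C) B) =
       scV (2 * om B C) A - scV (om A B) C + scV (om A C) B"

definition mu :: "('v \<Rightarrow> 'v \<Rightarrow> 'm) \<Rightarrow> 'v \<Rightarrow> 'm"
  where "mu Bmu A = Bmu A A"

definition Psi :: "('m \<Rightarrow> 'v \<Rightarrow> 'v) \<Rightarrow> ('v \<Rightarrow> 'v \<Rightarrow> 'm) \<Rightarrow> 'v \<Rightarrow> 'v"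
  where "Psi act Bmu A = act (mu Bmu A) A"

definition Qform ::
  "('m \<Rightarrow> 'v \<Rightarrow> 'v) \<Rightarrow> ('v \<Rightarrow> 'v \<Rightarrow> 'k::field) \<Rightarrow> ('v \<Rightarrow> 'v \<Rightarrow> 'm) \<Rightarrow> 'v \<Rightarrow> 'k"
  where "Qform act om Bmu A = 3 / 2 * om A (Psi act Bmu A)"


section \<open>The algebra \<open>A\<^sub>\<lambda>\<close> and base extension\<close>

text \<open>
  Since \<open>1\<close> and \<open>\<surd>\<lambda>\<close> form a \<open>k\<close>-basis of \<open>A\<^sub>\<lambda> = k[x]/\<langle>x\<^sup>2 - \<lambda>\<rangle>\<close>, every element of \<open>U \<otimes> A\<^sub>\<lambda>\<close>
  is uniquely \<open>P \<otimes> 1 + R \<otimes> \<surd>\<lambda>\<close>. It is represented by the pair \<open>(P, R)\<close>; in particular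
  \<open>A\<^sub>\<lambda>\<close> itself consists of the pairs \<open>(a, b)\<close> standing for \<open>a + b \<surd>\<lambda>\<close>. That these really are the
  quotient ring, the tensor product and the base extensions is proved below:
  \<open>Alam_iso_quotient\<close>, \<open>tens_bilin\<close>, \<open>tens_universal\<close>, \<open>ext_scale_tens\<close>, \<open>conj_lam_tens\<close>,
  \<open>ext_bilin_tens\<close>, \<open>ext_bilin_Alam_bilin\<close>.
\<close>

text \<open>The action \<open>(a + b\<surd>\<lambda>)(P + R\<surd>\<lambda>) = (aP + \<lambda>bR) + (aR + bP)\<surd>\<lambda>\<close> of \<open>A\<^sub>\<lambda>\<close> on \<open>U \<otimes> A\<^sub>\<lambda>\<close>.\<close>

definition ext_scale ::
  "'k::field \<Rightarrow> ('k \<Rightarrow> 'u::ab_group_add \<Rightarrow> 'u) \<Rightarrow> 'k \<times> 'k \<Rightarrow> 'u \<times> 'u \<Rightarrow> 'u \<times> 'u"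
  where "ext_scale lam s x v =
    (s (fst x) (fst v) + s (lam * snd x) (snd v), s (fst x) (snd v) + s (snd x) (fst v))"

definition Alam :: "'k::field \<Rightarrow> ('k \<times> 'k) ring"
  where "Alam lam = \<lparr>carrier = UNIV, monoid.mult = ext_scale lam (*), one = (1, 0), zero = (0, 0), add = (+)\<rparr>"

definition sqrt_lam :: "'k::field \<times> 'k"
  where "sqrt_lam = (0, 1)"

definition conj_lam :: "'u::ab_group_add \<times> 'u \<Rightarrow> 'u \<times> 'u"
  where "conj_lam v = (fst v, - snd v)"

text \<open>The inclusion \<open>P \<mapsto> P \<otimes> 1\<close> onto the fixed points of conjugation.\<close>

definition incl :: "'u::ab_group_add \<Rightarrow> 'u \<times> 'u"
  where "incl P = (P, 0)"

definition tens :: "('k \<Rightarrow> 'u \<Rightarrow> 'u) \<Rightarrow> 'u \<Rightarrow> 'k \<times> 'k \<Rightarrow> 'u \<times> 'u"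
  where "tens s P a = (s (fst a) P, s (snd a) P)"

definition pair_scale :: "('k \<Rightarrow> 'u \<Rightarrow> 'u) \<Rightarrow> ('k \<Rightarrow> 'w \<Rightarrow> 'w) \<Rightarrow> 'k \<Rightarrow> 'u \<times> 'w \<Rightarrow> 'u \<times> 'w"
  where "pair_scale s t c v = (s c (fst v), t c (snd v))"

text \<open>The \<open>A\<^sub>\<lambda>\<close>-bilinear extension of \<open>b : U \<times> U \<rightarrow> W\<close>; \<open>t\<close> is the scalar multiplication of \<open>W\<close>.\<close>

definition ext_bilin ::
  "'k::field \<Rightarrow> ('k \<Rightarrow> 'w::ab_group_add \<Rightarrow> 'w) \<Rightarrow> ('u \<Rightarrow> 'u \<Rightarrow> 'w) \<Rightarrow> 'u \<times> 'u \<Rightarrow> 'u \<times> 'u \<Rightarrow> 'w \<times> 'w"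
  where "ext_bilin lam t b v w =
    (b (fst v) (fst w) + t lam (b (snd v) (snd w)), b (fst v) (snd w) + b (snd v) (fst w))"

definition om_lam :: "'k::field \<Rightarrow> ('v \<Rightarrow> 'v \<Rightarrow> 'k) \<Rightarrow> 'v \<times> 'v \<Rightarrow> 'v \<times> 'v \<Rightarrow> 'k \<times> 'k"
  where "om_lam lam om = ext_bilin lam (*) om"

definition mu_lam ::
  "'k::field \<Rightarrow> ('k \<Rightarrow> 'm::ab_group_add \<Rightarrow> 'm) \<Rightarrow> ('v \<Rightarrow> 'v \<Rightarrow> 'm) \<Rightarrow> 'v \<times> 'v \<Rightarrow> 'm \<times> 'm"
  where "mu_lam lam scM Bmu v = ext_bilin lam scM Bmu v v"

text \<open>\<open>the_inv incl\<close> reads a fixed point of conjugation as an element of \<open>k\<close> (see \<open>range_incl\<close> and \<open>incl_hform\<close>).\<close>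

definition hform :: "'k::field \<Rightarrow> ('v::ab_group_add \<Rightarrow> 'v \<Rightarrow> 'k) \<Rightarrow> 'v \<times> 'v \<Rightarrow> 'k"
  where "hform lam om v =
    the_inv incl (inv\<^bsub>Alam lam\<^esub> sqrt_lam \<otimes>\<^bsub>Alam lam\<^esub> om_lam lam om (conj_lam v) v)"


section \<open>The two varieties, their rings of functions, and the maps\<close>

definition sigma :: "'v \<times> 'k::field \<Rightarrow> 'v \<times> 'k"
  where "sigma Ph = (fst Ph, - snd Ph)"

definition Qhat ::
  "('m \<Rightarrow> 'v \<Rightarrow> 'v) \<Rightarrow> ('v \<Rightarrow> 'v \<Rightarrow> 'k::field) \<Rightarrow> ('v \<Rightarrow> 'v \<Rightarrow> 'm) \<Rightarrow> 'v \<times> 'k \<Rightarrow> 'k"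
  where "Qhat act om Bmu Ph = Qform act om Bmu (fst Ph)"

definition Hhat :: "'v \<times> 'k \<Rightarrow> 'k"
  where "Hhat Ph = snd Ph"

definition Ohat ::
  "'k::field \<Rightarrow> ('m \<Rightarrow> 'v \<Rightarrow> 'v) \<Rightarrow> ('v \<Rightarrow> 'v \<Rightarrow> 'k) \<Rightarrow> ('v \<Rightarrow> 'v \<Rightarrow> 'm) \<Rightarrow> ('v \<times> 'k) set"
  where "Ohat lam act om Bmu =
    {Ph. Qhat act om Bmu Ph \<noteq> 0 \<and> Qhat act om Bmu Ph = lam * (Hhat Ph)\<^sup>2}"

definition Zgen ::
  "'k::field \<Rightarrow> ('k \<Rightarrow> 'm::ab_group_add \<Rightarrow> 'm) \<Rightarrow> ('v::ab_group_add \<Rightarrow> 'v \<Rightarrow> 'k) \<Rightarrow>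
   ('v \<Rightarrow> 'v \<Rightarrow> 'm) \<Rightarrow> ('v \<times> 'v) set"
  where "Zgen lam scM om Bmu = {v. hform lam om v \<noteq> 0 \<and> mu_lam lam scM Bmu v = 0}"

text \<open>Polynomial functions are generated, as a \<open>k\<close>-algebra of functions, by the linear functionals.\<close>

inductive_set poly_functions :: "('k::field \<Rightarrow> 'w::ab_group_add \<Rightarrow> 'w) \<Rightarrow> ('w \<Rightarrow> 'k) set"
  for s :: "'k \<Rightarrow> 'w \<Rightarrow> 'w" where
  const: "(\<lambda>_. c) \<in> poly_functions s"
| linear: "Vector_Spaces.linear s (*) f \<Longrightarrow> f \<in> poly_functions s"
| add: "f \<in> poly_functions s \<Longrightarrow> g \<in> poly_functions s \<Longrightarrow> (\<lambda>x. f x + g x) \<in> poly_functions s"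
| mult: "f \<in> poly_functions s \<Longrightarrow> g \<in> poly_functions s \<Longrightarrow> (\<lambda>x. f x * g x) \<in> poly_functions s"

text \<open>
  The restrictions to \<open>D\<close> of the elements \<open>p / g\<^sup>n\<close> of \<open>S(W\<^sup>*)[1/g]\<close>, for \<open>D\<close> on which \<open>g\<close> has no zero.
  Functions on \<open>D\<close> are normalised to be \<^const>\<open>undefined\<close> off \<open>D\<close>.
\<close>

definition restricted_ring ::
  "('k::field \<Rightarrow> 'w::ab_group_add \<Rightarrow> 'w) \<Rightarrow> ('w \<Rightarrow> 'k) \<Rightarrow> 'w set \<Rightarrow> ('w \<Rightarrow> 'k) set"
  where "restricted_ring s g D = {restrict (\<lambda>x. p x / g x ^ n) D | p n. p \<in> poly_functions s}"

definition R_Ohat ::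
  "'k::field \<Rightarrow> ('k \<Rightarrow> 'v::ab_group_add \<Rightarrow> 'v) \<Rightarrow> ('m \<Rightarrow> 'v \<Rightarrow> 'v) \<Rightarrow> ('v \<Rightarrow> 'v \<Rightarrow> 'k) \<Rightarrow>
   ('v \<Rightarrow> 'v \<Rightarrow> 'm) \<Rightarrow> ('v \<times> 'k \<Rightarrow> 'k) set"
  where "R_Ohat lam scV act om Bmu =
    restricted_ring (pair_scale scV (*)) (Qhat act om Bmu) (Ohat lam act om Bmu)"

definition R_Zgen ::
  "'k::field \<Rightarrow> ('k \<Rightarrow> 'm::ab_group_add \<Rightarrow> 'm) \<Rightarrow> ('k \<Rightarrow> 'v::ab_group_add \<Rightarrow> 'v) \<Rightarrow>
   ('v \<Rightarrow> 'v \<Rightarrow> 'k) \<Rightarrow> ('v \<Rightarrow> 'v \<Rightarrow> 'm) \<Rightarrow> ('v \<times> 'v \<Rightarrow> 'k) set"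
  where "R_Zgen lam scM scV om Bmu =
    restricted_ring (pair_scale scV scV) (hform lam om) (Zgen lam scM om Bmu)"

definition act_Vhat :: "('k::field \<Rightarrow> 'v \<Rightarrow> 'v) \<Rightarrow> 'k \<Rightarrow> 'v \<times> 'k \<Rightarrow> 'v \<times> 'k"
  where "act_Vhat scV a Ph = (scV a (fst Ph), a\<^sup>2 * snd Ph)"

definition alpha ::
  "'k::field \<Rightarrow> ('k \<Rightarrow> 'v::ab_group_add \<Rightarrow> 'v) \<Rightarrow> ('m \<Rightarrow> 'v \<Rightarrow> 'v) \<Rightarrow> ('v \<Rightarrow> 'v \<Rightarrow> 'm) \<Rightarrow>
   'v \<times> 'k \<Rightarrow> 'v \<times> 'v"
  where "alpha lam scV act Bmu = (\<lambda>(P, z).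
    pair_scale scV scV (1 / 2)
      (incl P + ext_scale lam scV (inv\<^bsub>Alam lam\<^esub> (incl z \<otimes>\<^bsub>Alam lam\<^esub> sqrt_lam)) (incl (Psi act Bmu P))))"

definition beta :: "'k::field \<Rightarrow> ('v::ab_group_add \<Rightarrow> 'v \<Rightarrow> 'k) \<Rightarrow> 'v \<times> 'v \<Rightarrow> 'v \<times> 'k"
  where "beta lam om v = (the_inv incl (v + conj_lam v), 3 * hform lam om v)"


section \<open>The pair model is the quotient ring, the tensor product and the base extension\<close>

definition poly_ring :: "'k::field poly ring"
  where "poly_ring = \<lparr>carrier = UNIV, monoid.mult = (*), one = 1, zero = 0, add = (+)\<rparr>"

definition lam_ideal :: "'k::field \<Rightarrow> 'k poly set"
  where "lam_ideal lam = PIdl\<^bsub>poly_ring\<^esub> [:- lam, 0, 1:]"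

definition to_quotient :: "'k::field \<Rightarrow> 'k \<times> 'k \<Rightarrow> 'k poly set"
  where "to_quotient lam x = lam_ideal lam +>\<^bsub>poly_ring\<^esub> [:fst x, snd x:]"

lemma poly_ring_cring: "cring (poly_ring :: 'k::field poly ring)"
proof (rule cringI)
  show "abelian_group (poly_ring :: 'k poly ring)"
  proof (rule abelian_groupI)
    fix p :: "'k poly"
    show "\<exists>q\<in>carrier poly_ring. q \<oplus>\<^bsub>poly_ring\<^esub> p = \<zero>\<^bsub>poly_ring\<^esub>"
      by (rule bexI[of _ "- p"]) (auto simp: poly_ring_def)
  qed (auto simp: poly_ring_def)
  show "comm_monoid (poly_ring :: 'k poly ring)"
    by (rule comm_monoidI) (auto simp: poly_ring_def)
qed (auto simp: poly_ring_def algebra_simps)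

lemma lam_ideal_eq: "lam_ideal lam = {p. [:- lam, 0, 1:] dvd p}"
  by (auto simp: lam_ideal_def cgenideal_def poly_ring_def dvd_def mult.commute)

lemma lam_ideal_ideal: "ideal (lam_ideal lam) (poly_ring :: 'k::field poly ring)"
proof -
  interpret cring "poly_ring :: 'k poly ring" by (rule poly_ring_cring)
  show ?thesis
    unfolding lam_ideal_def by (rule cgenideal_ideal) (simp add: poly_ring_def)
qed

lemma coset_eq: "lam_ideal lam +>\<^bsub>poly_ring\<^esub> p = {q. [:- lam, 0, 1:] dvd q - p}"
proof -
  have "lam_ideal lam +>\<^bsub>poly_ring\<^esub> p = {h + p | h. [:- lam, 0, 1:] dvd h}"
    by (auto simp: a_r_coset_def r_coset_def poly_ring_def lam_ideal_eq)
  also have "\<dots> = {q. [:- lam, 0, 1:] dvd q - p}"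
    by (auto intro: exI[of _ "q - p" for q])
  finally show ?thesis .
qed

lemma coset_eq_iff:
  "lam_ideal lam +>\<^bsub>poly_ring\<^esub> p = lam_ideal lam +>\<^bsub>poly_ring\<^esub> q \<longleftrightarrow> [:- lam, 0, 1:] dvd p - q"
proof
  assume "lam_ideal lam +>\<^bsub>poly_ring\<^esub> p = lam_ideal lam +>\<^bsub>poly_ring\<^esub> q"
  moreover have "p \<in> lam_ideal lam +>\<^bsub>poly_ring\<^esub> p" by (simp add: coset_eq)
  ultimately show "[:- lam, 0, 1:] dvd p - q" by (simp add: coset_eq)
next
  assume d: "[:- lam, 0, 1:] dvd p - q"
  have "[:- lam, 0, 1:] dvd r - p \<longleftrightarrow> [:- lam, 0, 1:] dvd r - q" for r
    using dvd_add_left_iff[OF d, of "r - p"] by simp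
  then show "lam_ideal lam +>\<^bsub>poly_ring\<^esub> p = lam_ideal lam +>\<^bsub>poly_ring\<^esub> q"
    by (simp add: coset_eq)
qed

lemma lin_dvd_imp_zero:
  assumes "[:- lam, 0, 1:] dvd [:a, b:]"
  shows "a = (0::'k::field) \<and> b = 0"
proof (rule ccontr)
  assume "\<not> ?thesis"
  then have "[:a, b:] \<noteq> 0" by auto
  from dvd_imp_degree_le[OF assms this] show False by (auto split: if_splits)
qed

lemma coset_rep: "\<exists>a b. [:- lam, 0, 1:] dvd (p :: 'k::field poly) - [:a, b:]"
proof -
  let ?m = "[:- lam, 0, 1:]"
  have "degree (p mod ?m) < 2"
    using degree_mod_less[of ?m p] by auto
  then have "p mod ?m = [:coeff (p mod ?m) 0, coeff (p mod ?m) 1:]"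
    by (intro poly_eqI) (auto simp: coeff_pCons coeff_eq_0 split: nat.split)
  moreover have "?m dvd p - p mod ?m" by (rule dvd_minus_mod)
  ultimately show ?thesis by metis
qed

theorem Alam_iso_quotient:
  fixes lam :: "'k::field"
  shows "to_quotient lam \<in> ring_iso (Alam lam) (poly_ring Quot lam_ideal lam)"
    and "to_quotient lam sqrt_lam = lam_ideal lam +>\<^bsub>poly_ring\<^esub> [:0, 1:]"
    and "to_quotient lam (conj_lam x) = (\<lambda>p. pcompose p [:0, - 1:]) ` to_quotient lam x"
proof -
  interpret I: ideal "lam_ideal lam" poly_ring by (rule lam_ideal_ideal)
  have carr: "carrier (poly_ring Quot lam_ideal lam) = range (\<lambda>p. lam_ideal lam +>\<^bsub>poly_ring\<^esub> p)"
  proof -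
    have "carrier (poly_ring :: 'k poly ring) = UNIV" by (simp add: poly_ring_def)
    then show ?thesis by (auto simp: FactRing_def A_RCOSETS_defs a_r_coset_def)
  qed
  show "to_quotient lam \<in> ring_iso (Alam lam) (poly_ring Quot lam_ideal lam)"
  proof (rule ring_iso_memI)
    fix x y :: "'k \<times> 'k"
    show "to_quotient lam x \<in> carrier (poly_ring Quot lam_ideal lam)"
      by (simp add: carr to_quotient_def)
    have "[:fst (ext_scale lam (*) x y), snd (ext_scale lam (*) x y):] -
        [:fst x, snd x:] * [:fst y, snd y:] = [:- lam, 0, 1:] * [:- (snd x * snd y):]"
      by (simp add: ext_scale_def algebra_simps)
    then have d: "[:- lam, 0, 1:] dvd [:fst (ext_scale lam (*) x y), snd (ext_scale lam (*) x y):] -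
        [:fst x, snd x:] * [:fst y, snd y:]"
      by (metis dvd_triv_left)
    have "to_quotient lam x \<otimes>\<^bsub>poly_ring Quot lam_ideal lam\<^esub> to_quotient lam y =
        lam_ideal lam +>\<^bsub>poly_ring\<^esub> ([:fst x, snd x:] * [:fst y, snd y:])"
      using I.rcoset_mult_add[of "[:fst x, snd x:]" "[:fst y, snd y:]"]
      by (simp add: to_quotient_def FactRing_def poly_ring_def)
    then show "to_quotient lam (x \<otimes>\<^bsub>Alam lam\<^esub> y) =
        to_quotient lam x \<otimes>\<^bsub>poly_ring Quot lam_ideal lam\<^esub> to_quotient lam y"
      using d by (simp add: to_quotient_def Alam_def coset_eq_iff)
    show "to_quotient lam (x \<oplus>\<^bsub>Alam lam\<^esub> y) =
        to_quotient lam x \<oplus>\<^bsub>poly_ring Quot lam_ideal lam\<^esub> to_quotient lam y"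
      using I.a_rcos_sum[of "[:fst x, snd x:]" "[:fst y, snd y:]"]
      by (simp add: to_quotient_def FactRing_def Alam_def poly_ring_def)
  next
    show "to_quotient lam \<one>\<^bsub>Alam lam\<^esub> = \<one>\<^bsub>poly_ring Quot lam_ideal lam\<^esub>"
      by (simp add: to_quotient_def FactRing_def Alam_def poly_ring_def one_pCons)
    have rep: "\<exists>x. to_quotient lam x = lam_ideal lam +>\<^bsub>poly_ring\<^esub> p" for p
      using coset_rep[of lam p]
      by (auto simp: to_quotient_def coset_eq_iff) (metis dvd_diff_commute fst_conv snd_conv)
    have "inj (to_quotient lam)"
    proof (rule injI)
      fix x y assume "to_quotient lam x = to_quotient lam y"
      then have "[:- lam, 0, 1:] dvd [:fst x - fst y, snd x - snd y:]"
        by (simp add: to_quotient_def coset_eq_iff)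
      then show "x = y" by (auto dest!: lin_dvd_imp_zero simp: prod_eq_iff)
    qed
    moreover have "range (to_quotient lam) = range (\<lambda>p. lam_ideal lam +>\<^bsub>poly_ring\<^esub> p)"
    proof
      show "range (to_quotient lam) \<subseteq> range (\<lambda>p. lam_ideal lam +>\<^bsub>poly_ring\<^esub> p)"
        by (auto simp: to_quotient_def)
      show "range (\<lambda>p. lam_ideal lam +>\<^bsub>poly_ring\<^esub> p) \<subseteq> range (to_quotient lam)"
        using rep by (metis image_subsetI rangeI)
    qed
    ultimately show "bij_betw (to_quotient lam) (carrier (Alam lam))
        (carrier (poly_ring Quot lam_ideal lam))"
      unfolding carr by (simp add: bij_betw_def Alam_def)
  qed
  show "to_quotient lam sqrt_lam = lam_ideal lam +>\<^bsub>poly_ring\<^esub> [:0, 1:]"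
    by (simp add: to_quotient_def sqrt_lam_def)
  have inv: "pcompose (pcompose p [:0, - 1:]) [:0, - 1:] = p" for p :: "'k poly"
    by (simp add: pcompose_assoc[symmetric] pcompose_pCons)
  have dv: "[:- lam, 0, 1:] dvd pcompose p [:0, - 1:]" if "[:- lam, 0, 1:] dvd p" for p
  proof -
    have fixed: "pcompose [:- lam, 0, 1:] [:0, - 1:] = [:- lam, 0, 1:]"
      by (simp add: pcompose_pCons)
    from that obtain q where "p = [:- lam, 0, 1:] * q" by (rule dvdE)
    then have "pcompose p [:0, - 1:] = [:- lam, 0, 1:] * pcompose q [:0, - 1:]"
      by (simp only: pcompose_mult fixed)
    then show ?thesis by (metis dvd_triv_left)
  qed
  have "q \<in> (\<lambda>p. pcompose p [:0, - 1:]) ` to_quotient lam x \<longleftrightarrow> q \<in> to_quotient lam (conj_lam x)" for q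
  proof -
    have "q \<in> (\<lambda>p. pcompose p [:0, - 1:]) ` to_quotient lam x \<longleftrightarrow> pcompose q [:0, - 1:] \<in> to_quotient lam x"
    proof
      assume "q \<in> (\<lambda>p. pcompose p [:0, - 1:]) ` to_quotient lam x"
      then obtain p where "p \<in> to_quotient lam x" "q = pcompose p [:0, - 1:]" by blast
      then show "pcompose q [:0, - 1:] \<in> to_quotient lam x" by (simp only: inv)
    next
      assume "pcompose q [:0, - 1:] \<in> to_quotient lam x"
      then show "q \<in> (\<lambda>p. pcompose p [:0, - 1:]) ` to_quotient lam x"
        by (rule image_eqI[rotated]) (simp only: inv)
    qed
    also have "\<dots> \<longleftrightarrow> [:- lam, 0, 1:] dvd pcompose q [:0, - 1:] - [:fst x, snd x:]"
      by (simp add: to_quotient_def coset_eq)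
    also have "\<dots> \<longleftrightarrow> [:- lam, 0, 1:] dvd pcompose (pcompose q [:0, - 1:] - [:fst x, snd x:]) [:0, - 1:]"
      using dv[of "pcompose q [:0, - 1:] - [:fst x, snd x:]"]
        dv[of "pcompose (pcompose q [:0, - 1:] - [:fst x, snd x:]) [:0, - 1:]"]
      unfolding inv by (rule iffI)
    also have "pcompose (pcompose q [:0, - 1:] - [:fst x, snd x:]) [:0, - 1:] = q - [:fst x, - snd x:]"
      by (simp add: pcompose_diff inv pcompose_pCons)
    finally show ?thesis by (simp add: to_quotient_def coset_eq conj_lam_def)
  qed
  then show "to_quotient lam (conj_lam x) = (\<lambda>p. pcompose p [:0, - 1:]) ` to_quotient lam x"
    by blast
qed

lemma pair_scale_vector_space:
  "vector_space s \<Longrightarrow> vector_space t \<Longrightarrow> vector_space (pair_scale s t)"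
  by (auto simp: vector_space_def pair_scale_def)

lemma field_vector_space: "vector_space ((*) :: 'k::field \<Rightarrow> 'k \<Rightarrow> 'k)"
  by unfold_locales (simp_all add: algebra_simps)

lemma tens_bilin:
  assumes "vector_space s"
  shows "bilin s (pair_scale (*) (*)) (pair_scale s s) (tens s)"
  using assms pair_scale_vector_space[OF assms assms]
    pair_scale_vector_space[OF field_vector_space field_vector_space]
  by (auto simp: bilin_def Vector_Spaces.linear_iff tens_def pair_scale_def vector_space_def algebra_simps)

theorem tens_universal:
  fixes s :: "'k::field \<Rightarrow> 'u::ab_group_add \<Rightarrow> 'u" and t :: "'k \<Rightarrow> 'w::ab_group_add \<Rightarrow> 'w"
  assumes s: "vector_space s" and t: "vector_space t" and b: "bilin s (pair_scale (*) (*)) t b"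
  shows "\<exists>!f. Vector_Spaces.linear (pair_scale s s) t f \<and> (\<forall>P a. f (tens s P a) = b P a)"
proof -
  interpret S: vector_space s by (rule s)
  interpret T: vector_space t by (rule t)
  have bl: "b (P + P') a = b P a + b P' a" "b (s c P) a = t c (b P a)"
    and br: "b P (a + a') = b P a + b P a'" "b P (pair_scale (*) (*) c a) = t c (b P a)" for P P' a a' c
    using b unfolding bilin_def Vector_Spaces.linear_iff by blast+
  define f where "f v = b (fst v) (1, 0) + b (snd v) (0, 1)" for v
  have split: "a = pair_scale (*) (*) (fst a) (1, 0) + pair_scale (*) (*) (snd a) (0, 1)"
    for a :: "'k \<times> 'k" by (simp add: pair_scale_def)
  have "Vector_Spaces.linear (pair_scale s s) t f"
    using pair_scale_vector_space[OF s s] t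
    by (auto simp: Vector_Spaces.linear_iff f_def bl pair_scale_def T.scale_right_distrib)
  moreover have "f (tens s P a) = b P a" for P a
    by (subst (2) split) (simp only: br f_def tens_def bl fst_conv snd_conv)
  moreover have "g = f" if "Vector_Spaces.linear (pair_scale s s) t g" "\<forall>P a. g (tens s P a) = b P a" for g
  proof
    fix v :: "'u \<times> 'u"
    have "v = tens s (fst v) (1, 0) + tens s (snd v) (0, 1)" by (simp add: tens_def)
    then have "g v = g (tens s (fst v) (1, 0)) + g (tens s (snd v) (0, 1))"
      using that(1) unfolding Vector_Spaces.linear_iff by metis
    then show "g v = f v" using that(2) by (simp add: f_def)
  qed
  ultimately show ?thesis by blast
qed

lemma ext_scale_tens:
  assumes "vector_space s"
  shows "ext_scale lam s x (tens s P a) = tens s P (x \<otimes>\<^bsub>Alam lam\<^esub> a)"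
proof -
  interpret vector_space s by (rule assms)
  show ?thesis
    by (simp add: ext_scale_def tens_def Alam_def scale_left_distrib algebra_simps)
qed

lemma conj_lam_tens:
  assumes "vector_space s"
  shows "conj_lam (tens s P a) = tens s P (conj_lam a)"
proof -
  interpret vector_space s by (rule assms)
  show ?thesis by (simp add: conj_lam_def tens_def)
qed

lemma ext_bilin_tens:
  assumes t: "vector_space t" and b: "bilin s s t b"
  shows "ext_bilin lam t b (tens s P x) (tens s R y) = tens t (b P R) (x \<otimes>\<^bsub>Alam lam\<^esub> y)"
proof -
  interpret vector_space t by (rule t)
  have "b (s c A) B = t c (b A B)" "b A (s c B) = t c (b A B)" for A B c
    using b by (auto simp: bilin_def Vector_Spaces.linear_iff)
  then show ?thesis
    by (simp add: ext_bilin_def tens_def ext_scale_def Alam_def scale_left_distrib algebra_simps)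
qed

lemma ext_bilin_Alam_bilin:
  assumes t: "vector_space t" and b: "bilin s s t b"
  shows "ext_bilin lam t b (v + v') w = ext_bilin lam t b v w + ext_bilin lam t b v' w"
    and "ext_bilin lam t b v (w + w') = ext_bilin lam t b v w + ext_bilin lam t b v w'"
    and "ext_bilin lam t b (ext_scale lam s x v) w = ext_scale lam t x (ext_bilin lam t b v w)"
    and "ext_bilin lam t b v (ext_scale lam s x w) = ext_scale lam t x (ext_bilin lam t b v w)"
proof -
  interpret vector_space t by (rule t)
  have *: "b (s c A) B = t c (b A B)" "b A (s c B) = t c (b A B)"
    "b (A + A') B = b A B + b A' B" "b A (B + B') = b A B + b A B'" for A B A' B' c
    using b by (auto simp: bilin_def Vector_Spaces.linear_iff)
  show "ext_bilin lam t b (v + v') w = ext_bilin lam t b v w + ext_bilin lam t b v' w"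
    and "ext_bilin lam t b v (w + w') = ext_bilin lam t b v w + ext_bilin lam t b v w'"
    and "ext_bilin lam t b (ext_scale lam s x v) w = ext_scale lam t x (ext_bilin lam t b v w)"
    and "ext_bilin lam t b v (ext_scale lam s x w) = ext_scale lam t x (ext_bilin lam t b v w)"
    by (simp_all add: ext_bilin_def ext_scale_def * scale_right_distrib algebra_simps)
qed

lemma inj_incl: "inj incl"
  by (auto simp: inj_def incl_def)

lemma range_incl:
  fixes s :: "'k::field \<Rightarrow> 'u::ab_group_add \<Rightarrow> 'u"
  assumes "vector_space s" and "(2::'k) \<noteq> 0"
  shows "range incl = {v :: 'u \<times> 'u. conj_lam v = v}"
proof -
  interpret vector_space s by (rule assms)
  have "R = 0" if "- R = R" for R :: 'u
  proof -
    have "s 2 R = R + R" using scale_left_distrib[of 1 1 R] by simp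
    also have "\<dots> = 0" using that by (metis add.right_inverse)
    finally show "R = 0" using assms(2) by simp
  qed
  then show ?thesis by (auto simp: incl_def conj_lam_def prod_eq_iff image_iff)
qed

lemma inv_Alam:
  assumes "x \<otimes>\<^bsub>Alam lam\<^esub> y = \<one>\<^bsub>Alam lam\<^esub>"
  shows "inv\<^bsub>Alam lam\<^esub> x = y"
proof -
  interpret comm_monoid "Alam lam"
    by (rule comm_monoidI) (auto simp: Alam_def ext_scale_def algebra_simps)
  show ?thesis using assms by (intro comm_inv_char) (auto simp: Alam_def)
qed

lemma incl_hform:
  fixes om :: "'v::ab_group_add \<Rightarrow> 'v \<Rightarrow> 'k::field"
  assumes "symplectic_space scV om" and "lam \<noteq> 0"
  shows "incl (hform lam om v) = inv\<^bsub>Alam lam\<^esub> sqrt_lam \<otimes>\<^bsub>Alam lam\<^esub> om_lam lam om (conj_lam v) v"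
proof -
  interpret symplectic_space scV om by fact
  have add: "om (A + A') B = om A B + om A' B" "om A (B + B') = om A B + om A B'" for A A' B B'
    using om_bilin by (auto simp: bilin_def Vector_Spaces.linear_iff)
  have zero: "om 0 B = 0" for B using add(1)[of 0 0 B] by (metis add_0_left add_right_cancel)
  have neg: "om (- A) B = - om A B" for A B
    using add(1)[of A "- A" B] zero by (simp add: eq_neg_iff_add_eq_0 add.commute)
  have "inv\<^bsub>Alam lam\<^esub> sqrt_lam = (0, 1 / lam)"
    using assms(2) by (intro inv_Alam) (simp add: Alam_def sqrt_lam_def ext_scale_def)
  then have "snd (inv\<^bsub>Alam lam\<^esub> sqrt_lam \<otimes>\<^bsub>Alam lam\<^esub> om_lam lam om (conj_lam v) v) = 0"
    by (simp add: Alam_def ext_scale_def om_lam_def ext_bilin_def conj_lam_def neg om_alt)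
  then have "inv\<^bsub>Alam lam\<^esub> sqrt_lam \<otimes>\<^bsub>Alam lam\<^esub> om_lam lam om (conj_lam v) v \<in> range incl"
    by (auto simp: incl_def image_iff prod_eq_iff)
  then show ?thesis unfolding hform_def by (rule f_the_inv_into_f[OF inj_incl])
qed

end

theory Submission
  imports Defs
begin

text \<open>
  In the coordinates \<open>v = P + R\<surd>\<lambda>\<close> everything becomes explicit: \<open>h(v) = 2\<omega>(P,R)\<close>,
  \<open>\<mu>\<^sub>\<lambda>(v) = (\<mu>(P) + \<lambda>\<mu>(R)) + 2B\<^sub>\<mu>(P,R)\<surd>\<lambda>\<close>, \<open>\<alpha>(P,z) = P/2 + (\<Psi>(P)/2\<lambda>z)\<surd>\<lambda>\<close> and
  \<open>\<beta>(v) = (2P, 6\<omega>(P,R))\<close>.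

  That \<open>\<alpha>\<close> lands in the zero set of \<open>\<mu>\<^sub>\<lambda>\<close> comes down to \<open>B\<^sub>\<mu>(P,\<Psi>(P)) = 0\<close> and
  \<open>\<mu>(\<Psi>(P)) = -Q(P)\<mu>(P)\<close> (\<open>Bmu_Psi\<close>, \<open>mu_Psi\<close>). The first is equivariance applied to
  \<open>[\<mu>(P),\<mu>(P)] = 0\<close>. Given it, the defining identity of an SSR yields \<open>\<mu>(P)\<cdot>\<Psi>(P) = Q(P)P\<close>
  (\<open>act_mu_Psi\<close>), and applying \<open>\<mu>(P)\<close> to \<open>B\<^sub>\<mu>(P,\<Psi>(P)) = 0\<close> gives the second.

  Conversely, if \<open>\<mu>\<^sub>\<lambda>(v) = 0\<close>, then \<open>\<mu>(P) = -\<lambda>\<mu>(R)\<close>, and the same identity, applied to \<open>R, R, P\<close>,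
  computes \<open>\<mu>(R)\<cdot>P\<close>; the result \<open>\<Psi>(P) = (3/2)\<lambda>\<omega>(P,R)R\<close> (\<open>Psi_of_mu_lam_zero\<close>) shows that \<open>R\<close>
  can be recovered from \<open>P\<close> and \<open>h(v)\<close>, which is what \<open>\<alpha>\<close> does.

  For the rings of functions it suffices to pull back linear coordinates and the inverse of the
  localised function (\<open>compose_in_restricted_ring\<close>). For \<open>\<alpha>\<close> the only denominator is \<open>z\<close>,
  and \<open>1/z = \<lambda>z/Q\<close> where \<open>Q = \<lambda>z\<^sup>2\<close>; for \<open>\<beta>\<close> one has \<open>Q(2P) = 9\<lambda>h\<^sup>2\<close>. Polynomiality of \<open>\<Psi>\<close>, \<open>Q\<close> and \<open>h\<close> uses a basis of \<open>V\<close>.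
\<close>

section \<open>Polynomial maps\<close>

text \<open>
  Testing against all linear functionals gives a notion that also fits a target of infinite
  dimension; in \<open>\<Psi>(P) = \<mu>(P)\<cdot>P\<close> the intermediate map \<open>\<mu>\<close> takes values in the Lie algebra.
\<close>

definition polynomial_map ::
  "('k::field \<Rightarrow> 'w::ab_group_add \<Rightarrow> 'w) \<Rightarrow> ('k \<Rightarrow> 'u::ab_group_add \<Rightarrow> 'u) \<Rightarrow> ('w \<Rightarrow> 'u) \<Rightarrow> bool"
  where "polynomial_map s t f \<longleftrightarrow>
    (\<forall>L. Vector_Spaces.linear t (*) L \<longrightarrow> (\<lambda>x. L (f x)) \<in> poly_functions s)"

lemma polynomial_mapD:
  "polynomial_map s t f \<Longrightarrow> Vector_Spaces.linear t (*) L \<Longrightarrow> (\<lambda>x. L (f x)) \<in> poly_functions s"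
  by (simp add: polynomial_map_def)

lemma linear_id_field: "Vector_Spaces.linear (*) (*) (\<lambda>x::'k::field. x)"
  by (simp add: Vector_Spaces.linear_iff field_vector_space)

lemma polynomial_map_field: "polynomial_map s (*) f \<Longrightarrow> f \<in> poly_functions s"
  using polynomial_mapD[OF _ linear_id_field] by fastforce

lemma linear_comp:
  "Vector_Spaces.linear s t f \<Longrightarrow> Vector_Spaces.linear t u g \<Longrightarrow> Vector_Spaces.linear s u (\<lambda>x. g (f x))"
  by (simp add: Vector_Spaces.linear_iff)

lemma linear_polynomial_map: "Vector_Spaces.linear s t f \<Longrightarrow> polynomial_map s t f"
  by (auto simp: polynomial_map_def intro: poly_functions.linear linear_comp)

lemma poly_functions_sum:
  assumes "finite I" "\<And>i. i \<in> I \<Longrightarrow> f i \<in> poly_functions s"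
  shows "(\<lambda>x. \<Sum>i\<in>I. f i x) \<in> poly_functions s"
  using assms by (induction I rule: finite_induct)
    (auto intro: poly_functions.const[of 0, simplified] poly_functions.add)

text \<open>
  Expanding \<open>g x\<close> in a basis, \<open>b (f x) (g x)\<close> is a sum of products of coordinates of \<open>g x\<close> with
  linear images of \<open>f x\<close>; hence only the second factor has to be finite-dimensional.
\<close>

lemma polynomial_map_bilin:
  fixes sV :: "'k::field \<Rightarrow> 'v::ab_group_add \<Rightarrow> 'v"
  assumes fin: "finite_dimensional_vector_space sV Basis"
    and b: "bilin sU sV sX b"
    and f: "polynomial_map s sU f" and g: "polynomial_map s sV g"
  shows "polynomial_map s sX (\<lambda>x. b (f x) (g x))"
  unfolding polynomial_map_def
proof (intro allI impI)
  interpret finite_dimensional_vector_space sV Basis by (rule fin)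
  fix L assume L: "Vector_Spaces.linear sX (*) L"
  let ?c = "\<lambda>v e. representation Basis v e"
  have c: "Vector_Spaces.linear sV (*) (\<lambda>v. ?c v e)" for e
    by (simp add: Vector_Spaces.linear_iff field_vector_space vector_space_axioms
        representation_add representation_scale independent_Basis span_Basis)
  have Lb: "Vector_Spaces.linear sV (*) (\<lambda>v. L (b u v))"
    and Lb': "Vector_Spaces.linear sU (*) (\<lambda>u. L (b u v))" for u v
    using b L linear_comp unfolding bilin_def by blast+
  have expansion: "L (b u v) = (\<Sum>e\<in>Basis. ?c v e * L (b u e))" for u v
  proof -
    interpret L: Vector_Spaces.linear sV "(*)" "\<lambda>v. L (b u v)" by (rule Lb)
    have "L (b u v) = L (b u (\<Sum>e\<in>Basis. sV (?c v e) e))"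
      by (subst sum_representation_eq) (simp_all add: independent_Basis span_Basis finite_Basis)
    then show ?thesis by (simp only: L.sum L.scale)
  qed
  have "(\<lambda>x. \<Sum>e\<in>Basis. ?c (g x) e * L (b (f x) e)) \<in> poly_functions s"
    by (intro poly_functions_sum finite_Basis poly_functions.mult
        polynomial_mapD[OF g c] polynomial_mapD[OF f Lb'])
  then show "(\<lambda>x. L (b (f x) (g x))) \<in> poly_functions s"
    by (subst expansion)
qed

section \<open>Regular functions and pullback\<close>

lemma poly_functions_power: "f \<in> poly_functions s \<Longrightarrow> (\<lambda>x. f x ^ n) \<in> poly_functions s"
  by (induction n) (auto intro: poly_functions.const poly_functions.mult)

lemma poly_functions_cmult: "f \<in> poly_functions s \<Longrightarrow> (\<lambda>x. c * f x) \<in> poly_functions s"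
  by (intro poly_functions.mult poly_functions.const)

definition regular_on ::
  "('k::field \<Rightarrow> 'w::ab_group_add \<Rightarrow> 'w) \<Rightarrow> ('w \<Rightarrow> 'k) \<Rightarrow> 'w set \<Rightarrow> ('w \<Rightarrow> 'k) \<Rightarrow> bool"
  where "regular_on s g D F \<longleftrightarrow> (\<exists>p\<in>poly_functions s. \<exists>n. \<forall>x\<in>D. F x = p x / g x ^ n)"

lemma regular_onI:
  "p \<in> poly_functions s \<Longrightarrow> (\<And>x. x \<in> D \<Longrightarrow> F x = p x / g x ^ n) \<Longrightarrow> regular_on s g D F"
  by (auto simp: regular_on_def)

lemma restrict_in_restricted_ring_iff:
  "restrict F D \<in> restricted_ring s g D \<longleftrightarrow> regular_on s g D F"
proof
  assume "restrict F D \<in> restricted_ring s g D"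
  then obtain p n where p: "p \<in> poly_functions s"
    and eq: "restrict F D = restrict (\<lambda>x. p x / g x ^ n) D"
    by (auto simp: restricted_ring_def)
  show "regular_on s g D F"
    using p
  proof (rule regular_onI)
    show "F x = p x / g x ^ n" if "x \<in> D" for x
      using fun_cong[OF eq, of x] that by simp
  qed
next
  assume "regular_on s g D F"
  then obtain p n where "p \<in> poly_functions s" "\<forall>x\<in>D. F x = p x / g x ^ n"
    by (auto simp: regular_on_def)
  then show "restrict F D \<in> restricted_ring s g D"
    unfolding restricted_ring_def by (auto intro!: exI[of _ p] exI[of _ n] restrict_ext)
qed

lemma poly_regular_on: "p \<in> poly_functions s \<Longrightarrow> regular_on s g D p"
  by (rule regular_onI[where n = 0]) auto

lemma regular_on_add:
  assumes g: "g \<in> poly_functions s" "\<And>x. x \<in> D \<Longrightarrow> g x \<noteq> 0"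
    and "regular_on s g D F" "regular_on s g D G"
  shows "regular_on s g D (\<lambda>x. F x + G x)"
proof -
  obtain p m q n where p: "p \<in> poly_functions s" "\<forall>x\<in>D. F x = p x / g x ^ m"
    and q: "q \<in> poly_functions s" "\<forall>x\<in>D. G x = q x / g x ^ n"
    using assms(3,4) by (auto simp: regular_on_def)
  show ?thesis
  proof (rule regular_onI)
    show "(\<lambda>x. p x * g x ^ n + q x * g x ^ m) \<in> poly_functions s"
      by (intro poly_functions.add poly_functions.mult poly_functions_power p q g)
    show "F x + G x = (p x * g x ^ n + q x * g x ^ m) / g x ^ (m + n)" if "x \<in> D" for x
      using p q g(2)[OF that] that by (simp add: field_simps power_add)
  qed
qed

lemma regular_on_mult:
  assumes "regular_on s g D F" "regular_on s g D G"
  shows "regular_on s g D (\<lambda>x. F x * G x)"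
proof -
  obtain p m q n where p: "p \<in> poly_functions s" "\<forall>x\<in>D. F x = p x / g x ^ m"
    and q: "q \<in> poly_functions s" "\<forall>x\<in>D. G x = q x / g x ^ n"
    using assms by (auto simp: regular_on_def)
  show ?thesis
  proof (rule regular_onI)
    show "(\<lambda>x. p x * q x) \<in> poly_functions s"
      by (intro poly_functions.mult p q)
    show "F x * G x = (p x * q x) / g x ^ (m + n)" if "x \<in> D" for x
      using p q that by (simp add: power_add)
  qed
qed

lemma regular_on_power:
  "regular_on s g D F \<Longrightarrow> regular_on s g D (\<lambda>x. F x ^ n)"
  by (induction n) (auto intro: poly_regular_on poly_functions.const regular_on_mult)

text \<open>
  The universal property of the localised polynomial ring: a pullback is determined by what
  happens to linear functionals and to the inverse of the localised function.
\<close>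

lemma compose_in_restricted_ring:
  assumes g: "g \<in> poly_functions s" "\<And>x. x \<in> D \<Longrightarrow> g x \<noteq> 0"
    and \<phi>: "\<phi> \<in> D \<rightarrow> E"
    and lin: "\<And>L. Vector_Spaces.linear t (*) L \<Longrightarrow> regular_on s g D (\<lambda>x. L (\<phi> x))"
    and inverse: "regular_on s g D (\<lambda>x. 1 / d (\<phi> x))"
    and F: "F \<in> restricted_ring t d E"
  shows "compose D F \<phi> \<in> restricted_ring s g D"
proof -
  obtain p n where p: "p \<in> poly_functions t" and F_eq: "F = restrict (\<lambda>x. p x / d x ^ n) E"
    using F by (auto simp: restricted_ring_def)
  from p have "regular_on s g D (\<lambda>x. p (\<phi> x))"
    by induction
      (auto intro: poly_regular_on poly_functions.const lin regular_on_add[OF g] regular_on_mult)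
  then have "regular_on s g D (\<lambda>x. p (\<phi> x) * (1 / d (\<phi> x)) ^ n)"
    by (intro regular_on_mult regular_on_power inverse)
  moreover have "compose D F \<phi> = restrict (\<lambda>x. p (\<phi> x) * (1 / d (\<phi> x)) ^ n) D"
    using \<phi> by (auto simp: compose_def F_eq fun_eq_iff power_divide)
  ultimately show ?thesis by (simp add: restrict_in_restricted_ring_iff)
qed

lemma linear_pair_split:
  assumes "Vector_Spaces.linear (pair_scale s t) (*) L" "vector_space s" "vector_space t"
  shows "L (a, b) = L (a, 0) + L (0, b)"
    and "Vector_Spaces.linear s (*) (\<lambda>a. L (a, 0))"
    and "Vector_Spaces.linear t (*) (\<lambda>b. L (0, b))"
proof -
  interpret S: vector_space s by (rule assms)
  interpret T: vector_space t by (rule assms)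
  have add: "L (x + y) = L x + L y" and scale: "L (pair_scale s t c x) = c * L x" for x y c
    using assms(1) unfolding Vector_Spaces.linear_iff by blast+
  show "L (a, b) = L (a, 0) + L (0, b)"
    using add[of "(a, 0)" "(0, b)"] by simp
  show "Vector_Spaces.linear s (*) (\<lambda>a. L (a, 0))"
    using add[of "(_, 0)" "(_, 0)"] scale[of _ "(_, 0)"] assms(2)
    by (simp add: Vector_Spaces.linear_iff field_vector_space pair_scale_def)
  show "Vector_Spaces.linear t (*) (\<lambda>b. L (0, b))"
    using add[of "(0, _)" "(0, _)"] scale[of _ "(0, _)"] assms(3)
    by (simp add: Vector_Spaces.linear_iff field_vector_space pair_scale_def)
qed

lemma linear_fst:
  "vector_space s \<Longrightarrow> vector_space t \<Longrightarrow> Vector_Spaces.linear (pair_scale s t) s fst"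
  and linear_snd:
  "vector_space s \<Longrightarrow> vector_space t \<Longrightarrow> Vector_Spaces.linear (pair_scale s t) t snd"
  using pair_scale_vector_space[of s t]
  by (auto simp: Vector_Spaces.linear_iff) (auto simp: pair_scale_def)

section \<open>Identities for the covariants\<close>

locale ssr_char_not_2_3 = special_symplectic_rep scM brk scV act om Bmu
  for scM :: "'k::field \<Rightarrow> 'm::ab_group_add \<Rightarrow> 'm"
    and brk :: "'m \<Rightarrow> 'm \<Rightarrow> 'm"
    and scV :: "'k \<Rightarrow> 'v::ab_group_add \<Rightarrow> 'v"
    and act :: "'m \<Rightarrow> 'v \<Rightarrow> 'v"
    and om :: "'v \<Rightarrow> 'v \<Rightarrow> 'k"
    and Bmu :: "'v \<Rightarrow> 'v \<Rightarrow> 'm" +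
  fixes lam :: 'k
  assumes two: "(2::'k) \<noteq> 0" and three: "(3::'k) \<noteq> 0" and lam: "lam \<noteq> 0"
begin

abbreviation "\<Psi> \<equiv> Psi act Bmu"
abbreviation "Q \<equiv> Qform act om Bmu"
abbreviation "h \<equiv> hform lam om"
abbreviation "\<O> \<equiv> Ohat lam act om Bmu"
abbreviation "Z \<equiv> Zgen lam scM om Bmu"
abbreviation "\<alpha> \<equiv> alpha lam scV act Bmu"
abbreviation "\<beta> \<equiv> beta lam om"

lemma six: "(6::'k) \<noteq> 0"
  using two three mult_eq_0_iff[of "2::'k" 3] by simp

lemma four: "(4::'k) \<noteq> 0"
  using two mult_eq_0_iff[of "2::'k" 2] by simp

lemma act_linear:
  "act (x + y) A = act x A + act y A" "act (scM c x) A = scV c (act x A)"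
  "act x (A + B) = act x A + act x B" "act x (scV c A) = scV c (act x A)"
  using act_bilin by (auto simp: bilin_def Vector_Spaces.linear_iff)

lemma om_linear:
  "om (A + A') B = om A B + om A' B" "om (scV c A) B = c * om A B"
  "om A (B + B') = om A B + om A B'" "om A (scV c B) = c * om A B"
  using om_bilin by (auto simp: bilin_def Vector_Spaces.linear_iff)

lemma Bmu_linear:
  "Bmu (A + A') B = Bmu A B + Bmu A' B" "Bmu (scV c A) B = scM c (Bmu A B)"
  "Bmu A (B + B') = Bmu A B + Bmu A B'" "Bmu A (scV c B) = scM c (Bmu A B)"
  using Bmu_bilin by (auto simp: bilin_def Vector_Spaces.linear_iff)

lemma zero_simps [simp]: "act 0 A = 0" "act x 0 = 0" "brk x 0 = 0" "om 0 A = 0"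
proof -
  have "brk x (scM 0 0) = scM 0 (brk x 0)"
    using brk_bilin by (simp only: bilin_def Vector_Spaces.linear_iff)
  then show "brk x 0 = 0" by simp
qed (use act_linear(2)[of 0 0 A] act_linear(4)[of x 0 0] om_linear(2)[of 0 0 A] in simp_all)

lemma om_minus: "om (- A) B = - om A B"
  using om_linear(1)[of A "- A" B] by (simp add: eq_neg_iff_add_eq_0 add.commute)

lemma om_antisym: "om B A = - om A B"
proof -
  have "om (A + B) (A + B) = om A B + om B A"
    unfolding om_linear by (simp add: om_alt add.commute)
  then have "om A B + om B A = 0" by (simp only: om_alt)
  then show ?thesis by (simp add: add_eq_0_iff)
qed

lemma double_V: "scV 2 A = A + A"
  using V.scale_left_distrib[of 1 1 A] by simp

lemma double_M: "scM 2 x = x + x"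
  using scale_left_distrib[of 1 1 x] by simp

lemma Psi_scale: "\<Psi> (scV c A) = scV (c ^ 3) (\<Psi> A)"
  by (simp add: Psi_def mu_def act_linear Bmu_linear power3_eq_cube mult.assoc)

lemma Q_scale: "Q (scV c A) = c ^ 4 * Q A"
  by (simp add: Qform_def Psi_scale om_linear algebra_simps power_numeral_reduce)

text \<open>Equivariance for \<open>m = \<mu>(A)\<close> reads \<open>0 = [\<mu>(A),\<mu>(A)] = 2B\<^sub>\<mu>(A,\<Psi>(A))\<close>.\<close>

lemma Bmu_Psi: "Bmu A (\<Psi> A) = 0"
proof -
  have "scM 2 (Bmu A (\<Psi> A)) = brk (Bmu A A) (Bmu A A)"
    unfolding Bmu_equivariant Psi_def mu_def double_M by (simp add: Bmu_sym)
  then show ?thesis using two by (simp add: brk_alt)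
qed

text \<open>If \<open>B\<^sub>\<mu>(A,C) = 0\<close>, the terms of the defining identity other than \<open>\<mu>(A)\<cdot>C\<close> are multiples of \<open>A\<close>.\<close>

lemma act_mu_orthogonal:
  assumes "Bmu A C = 0"
  shows "act (Bmu A A) C = scV (3 / 2 * om A C) A"
proof -
  have "scV 2 (act (Bmu A A) C) = scV (2 * om A C) A + scV (om A C) A"
    using Bmu_identity[of A A C] assms by (simp add: om_alt)
  also have "\<dots> = scV (2 * om A C + om A C) A"
    by (simp only: V.scale_left_distrib)
  also have "2 * om A C + om A C = 2 * (3 / 2 * om A C)"
    using two by simp
  finally have "scV 2 (act (Bmu A A) C) = scV 2 (scV (3 / 2 * om A C) A)"
    by (simp only: V.scale_scale)
  then show ?thesis using two by (simp only: V.scale_cancel_left simp_thms)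
qed

lemma act_mu_Psi: "act (Bmu A A) (\<Psi> A) = scV (Q A) A"
  using act_mu_orthogonal[OF Bmu_Psi] by (simp add: Qform_def)

text \<open>Apply \<open>\<mu>(A)\<close> to \<open>B\<^sub>\<mu>(A,\<Psi>(A)) = 0\<close>, using \<open>\<mu>(A)\<cdot>\<Psi>(A) = Q(A)A\<close>.\<close>

lemma mu_Psi: "Bmu (\<Psi> A) (\<Psi> A) + scM (Q A) (Bmu A A) = 0"
  using Bmu_equivariant[of "Bmu A A" A "\<Psi> A"]
  by (simp add: Bmu_Psi act_mu_Psi Bmu_linear) (simp add: Psi_def mu_def)

section \<open>Coordinates on the two varieties\<close>

lemma hform_eq: "h v = 2 * om (fst v) (snd v)"
proof -
  have "inv\<^bsub>Alam lam\<^esub> sqrt_lam = (0, 1 / lam)"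
    using lam by (intro inv_Alam) (simp add: Alam_def sqrt_lam_def ext_scale_def)
  then have "incl (h v) = incl (2 * om (fst v) (snd v))"
    unfolding incl_hform[OF symplectic_space_axioms lam]
    using lam om_antisym[of "snd v" "fst v"]
    by (simp only:) (simp add: incl_def Alam_def ext_scale_def om_lam_def
        ext_bilin_def conj_lam_def om_minus om_alt)
  then show ?thesis by (simp add: incl_def)
qed

lemma mem_Zgen_iff:
  "v \<in> Z \<longleftrightarrow> om (fst v) (snd v) \<noteq> 0 \<and> Bmu (fst v) (snd v) = 0 \<and>
     Bmu (fst v) (fst v) + scM lam (Bmu (snd v) (snd v)) = 0"
proof -
  have "Bmu (fst v) (snd v) + Bmu (snd v) (fst v) = scM 2 (Bmu (fst v) (snd v))"
    by (simp add: double_M Bmu_sym)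
  then show ?thesis
    using two by (auto simp: Zgen_def hform_eq mu_lam_def ext_bilin_def prod_eq_iff)
qed

lemma mem_Ohat_iff: "(P, z) \<in> \<O> \<longleftrightarrow> z \<noteq> 0 \<and> Q P = lam * z\<^sup>2"
  using lam by (auto simp: Ohat_def Qhat_def Hhat_def)

lemma alpha_eq:
  assumes "z \<noteq> 0"
  shows "\<alpha> (P, z) = (scV (1 / 2) P, scV (1 / (2 * lam * z)) (\<Psi> P))"
proof -
  have "inv\<^bsub>Alam lam\<^esub> (incl z \<otimes>\<^bsub>Alam lam\<^esub> sqrt_lam) = (0, 1 / (lam * z))"
    using lam assms by (intro inv_Alam) (simp add: Alam_def sqrt_lam_def incl_def ext_scale_def)
  then show ?thesis
    by (simp add: alpha_def ext_scale_def incl_def pair_scale_def mult.assoc)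
qed

lemma beta_eq: "\<beta> v = (scV 2 (fst v), 6 * om (fst v) (snd v))"
proof -
  have "v + conj_lam v = incl (scV 2 (fst v))"
    by (simp add: conj_lam_def incl_def double_V prod_eq_iff)
  then show ?thesis
    by (simp add: beta_def hform_eq the_inv_f_f[OF inj_incl])
qed

text \<open>
  On the zero set of \<open>\<mu>\<^sub>\<lambda>\<close> one has \<open>\<mu>(P) = -\<lambda>\<mu>(R)\<close>, so \<open>\<Psi>(P) = -\<lambda>\<mu>(R)\<cdot>P\<close>, which is a multiple of
  \<open>R\<close> because \<open>B\<^sub>\<mu>(R,P) = 0\<close>.
\<close>

lemma Psi_of_mu_lam_zero:
  assumes "Bmu P R = 0" "Bmu P P + scM lam (Bmu R R) = 0"
  shows "\<Psi> P = scV (3 / 2 * lam * om P R) R"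
proof -
  have "act (Bmu R R) P = scV (3 / 2 * om R P) R"
    using assms(1) by (intro act_mu_orthogonal) (simp add: Bmu_sym)
  then have "act (scM lam (Bmu R R)) P = scV (- (3 / 2 * lam * om P R)) R"
    using om_antisym[of R P] by (simp add: act_linear algebra_simps)
  moreover have "\<Psi> P = - act (scM lam (Bmu R R)) P"
    using assms(2) by (simp add: Psi_def mu_def eq_neg_iff_add_eq_0 flip: act_linear(1))
  ultimately show ?thesis by simp
qed

section \<open>The maps are mutually inverse and equivariant\<close>

lemma alpha_sigma:
  assumes "Ph \<in> \<O>"
  shows "\<alpha> (sigma Ph) = conj_lam (\<alpha> Ph)"
  using assms by (cases Ph) (simp add: mem_Ohat_iff sigma_def alpha_eq conj_lam_def)

lemma alpha_act:
  assumes "Ph \<in> \<O>" "a \<noteq> 0"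
  shows "\<alpha> (act_Vhat scV a Ph) = pair_scale scV scV a (\<alpha> Ph)"
  using assms by (cases Ph)
    (simp add: mem_Ohat_iff act_Vhat_def alpha_eq pair_scale_def Psi_scale
      power2_eq_square power3_eq_cube field_simps)

lemma beta_act: "\<beta> (pair_scale scV scV a v) = act_Vhat scV a (\<beta> v)"
  by (simp add: beta_eq pair_scale_def act_Vhat_def om_linear power2_eq_square mult.commute)

lemma om_Psi: "om P (\<Psi> P) = 2 / 3 * Q P"
  using six by (simp add: Qform_def)

lemma om_alpha:
  assumes "(P, z) \<in> \<O>"
  shows "om (fst (\<alpha> (P, z))) (snd (\<alpha> (P, z))) = z / 6"
  using assms lam two three six
  by (simp add: mem_Ohat_iff alpha_eq om_linear om_Psi power2_eq_square field_simps)

lemma alpha_in_Zgen: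
  assumes "Ph \<in> \<O>"
  shows "\<alpha> Ph \<in> Z"
proof -
  obtain P z where Ph: "Ph = (P, z)" by fastforce
  then have O: "(P, z) \<in> \<O>" and z: "z \<noteq> 0" and Q: "Q P = lam * z\<^sup>2"
    using assms by (auto simp: mem_Ohat_iff)
  have "Bmu (\<Psi> P) (\<Psi> P) = scM (- (lam * z\<^sup>2)) (Bmu P P)"
    using mu_Psi[of P] by (simp add: Q eq_neg_iff_add_eq_0)
  \<comment> \<open>\<open>\<mu>(\<Psi>(P)) = -\<lambda>z\<^sup>2\<mu>(P)\<close> makes both terms of \<open>\<mu>(P/2) + \<lambda>\<mu>(\<Psi>(P)/2\<lambda>z)\<close> multiples of \<open>\<mu>(P)\<close>\<close>
  then have "Bmu (scV (1 / 2) P) (scV (1 / 2) P) +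
      scM lam (Bmu (scV (1 / (2 * lam * z)) (\<Psi> P)) (scV (1 / (2 * lam * z)) (\<Psi> P))) =
      scM (1 / 2 * (1 / 2) + lam * (1 / (2 * lam * z) * (1 / (2 * lam * z) * - (lam * z\<^sup>2)))) (Bmu P P)"
    by (simp only: Bmu_linear scale_scale scale_left_distrib)
  also have "1 / 2 * (1 / 2) + lam * (1 / (2 * lam * z) * (1 / (2 * lam * z) * - (lam * z\<^sup>2))) = 0"
    using z lam two four by (simp add: power2_eq_square field_simps)
  finally show ?thesis
    using om_alpha[OF O] z six
    by (simp only: Ph mem_Zgen_iff) (simp add: alpha_eq Bmu_linear Bmu_Psi)
qed

lemma beta_alpha:
  assumes "Ph \<in> \<O>"
  shows "\<beta> (\<alpha> Ph) = Ph"
proof -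
  obtain P z where Ph: "Ph = (P, z)" by fastforce
  then have O: "(P, z) \<in> \<O>" and z: "z \<noteq> 0"
    using assms by (auto simp: mem_Ohat_iff)
  show ?thesis
    unfolding Ph beta_eq om_alpha[OF O] using z six two by (simp add: alpha_eq)
qed

lemma beta_in_Ohat:
  assumes "v \<in> Z"
  shows "\<beta> v \<in> \<O>"
proof -
  obtain P R where v: "v = (P, R)" by fastforce
  then have w: "om P R \<noteq> 0" and "\<Psi> P = scV (3 / 2 * lam * om P R) R"
    using assms Psi_of_mu_lam_zero by (auto simp: mem_Zgen_iff)
  then have "Q P = 3 / 2 * (3 / 2 * lam * om P R * om P R)"
    by (simp add: Qform_def om_linear)
  then have "Q (scV 2 P) = lam * (6 * om P R)\<^sup>2"
    unfolding Q_scale using two four by (simp only:) (simp add: power2_eq_square field_simps)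
  then show ?thesis using w six by (simp add: v beta_eq mem_Ohat_iff)
qed

lemma alpha_beta:
  assumes "v \<in> Z"
  shows "\<alpha> (\<beta> v) = v"
proof -
  obtain P R where v: "v = (P, R)" by fastforce
  then have w: "om P R \<noteq> 0" and \<Psi>: "\<Psi> P = scV (3 / 2 * lam * om P R) R"
    using assms Psi_of_mu_lam_zero by (auto simp: mem_Zgen_iff)
  have "1 / (2 * lam * (6 * om P R)) * (2 ^ 3 * (3 / 2 * lam * om P R)) = 1"
    using w lam two three six mult_eq_0_iff[of "4::'k" 6] four by (simp add: field_simps)
  then have "scV (1 / (2 * lam * (6 * om P R))) (\<Psi> (scV 2 P)) = R"
    by (simp only: Psi_scale \<Psi> V.scale_scale V.scale_one)
  then show ?thesis using w six two by (simp add: v beta_eq alpha_eq)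
qed

section \<open>The maps are regular\<close>

lemma bilin_polynomial_map:
  assumes "bilin sU scV sX b" "polynomial_map s sU f" "polynomial_map s scV g"
  shows "polynomial_map s sX (\<lambda>x. b (f x) (g x))"
  using finite_dim polynomial_map_bilin[OF _ assms] by blast

lemma Psi_polynomial_map: "polynomial_map s scV f \<Longrightarrow> polynomial_map s scV (\<lambda>x. \<Psi> (f x))"
  unfolding Psi_def mu_def
  by (intro bilin_polynomial_map[OF act_bilin] bilin_polynomial_map[OF Bmu_bilin])

lemma linear_fst_Vhat: "Vector_Spaces.linear (pair_scale scV (*)) scV fst"
  by (rule linear_fst[OF V.vector_space_axioms field_vector_space])

lemma Qhat_poly: "Qhat act om Bmu \<in> poly_functions (pair_scale scV (*))"
proof -
  have fst: "polynomial_map (pair_scale scV (*)) scV fst"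
    by (rule linear_polynomial_map[OF linear_fst_Vhat])
  have "(\<lambda>Ph. om (fst Ph) (\<Psi> (fst Ph))) \<in> poly_functions (pair_scale scV (*))"
    by (intro polynomial_map_field bilin_polynomial_map[OF om_bilin] Psi_polynomial_map fst)
  from poly_functions_cmult[OF this, of "3 / 2"] show ?thesis
    by (simp add: Qhat_def[abs_def] Qform_def)
qed

lemma hform_poly: "h \<in> poly_functions (pair_scale scV scV)"
proof -
  have "(\<lambda>v. om (fst v) (snd v)) \<in> poly_functions (pair_scale scV scV)"
    by (intro polynomial_map_field bilin_polynomial_map[OF om_bilin] linear_polynomial_map
        linear_fst linear_snd V.vector_space_axioms)
  from poly_functions_cmult[OF this, of 2] show ?thesis
    by (simp add: hform_eq[abs_def])
qed

lemma snd_poly_Vhat: "snd \<in> poly_functions (pair_scale scV (*))"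
  by (intro poly_functions.linear linear_snd V.vector_space_axioms field_vector_space)

lemma alpha_pullback:
  assumes "f \<in> R_Zgen lam scM scV om Bmu"
  shows "compose \<O> f \<alpha> \<in> R_Ohat lam scV act om Bmu"
  unfolding R_Ohat_def
proof (rule compose_in_restricted_ring)
  show "Qhat act om Bmu \<in> poly_functions (pair_scale scV (*))" by (rule Qhat_poly)
  show "Qhat act om Bmu x \<noteq> 0" if "x \<in> \<O>" for x using that unfolding Ohat_def by blast
  show "\<alpha> \<in> \<O> \<rightarrow> Z" using alpha_in_Zgen by blast
  show "f \<in> restricted_ring (pair_scale scV scV) h Z" using assms by (simp add: R_Zgen_def)
  show "regular_on (pair_scale scV (*)) (Qhat act om Bmu) \<O> (\<lambda>x. 1 / h (\<alpha> x))"
  proof (rule regular_onI)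
    show "(\<lambda>x. 3 * lam * snd x) \<in> poly_functions (pair_scale scV (*))"
      by (rule poly_functions_cmult[OF snd_poly_Vhat])
    fix x assume x: "x \<in> \<O>"
    obtain P z where Pz: "x = (P, z)" by fastforce
    have "(P, z) \<in> \<O>" using x by (simp only: Pz)
    then have "h (\<alpha> x) = 2 * (z / 6)" by (simp only: Pz hform_eq om_alpha)
    also have "\<dots> = z / 3" using three six by (simp add: frac_eq_eq)
    finally have h_eq: "h (\<alpha> x) = z / 3" .
    \<comment> \<open>\<open>3 / z = 3\<lambda>z / Q\<close>\<close>
    show "1 / h (\<alpha> x) = 3 * lam * snd x / Qhat act om Bmu x ^ 1"
      unfolding h_eq using x three lam by (simp add: Pz mem_Ohat_iff Qhat_def power2_eq_square)
  qed
next
  fix L assume L: "Vector_Spaces.linear (pair_scale scV scV) (*) L"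
  note split = linear_pair_split[OF L V.vector_space_axioms V.vector_space_axioms]
  have scale: "L (scV c A, 0) = c * L (A, 0)" "L (0, scV c A) = c * L (0, A)" for c A
    using split(2,3) by (simp_all add: Vector_Spaces.linear_iff)
  have fst: "(\<lambda>x. L (fst x, 0)) \<in> poly_functions (pair_scale scV (*))"
    by (intro poly_functions.linear linear_comp[OF linear_fst_Vhat split(2)])
  have \<Psi>: "(\<lambda>x. L (0, \<Psi> (fst x))) \<in> poly_functions (pair_scale scV (*))"
    by (intro polynomial_mapD[OF _ split(3)] Psi_polynomial_map
        linear_polynomial_map linear_fst_Vhat)
  show "regular_on (pair_scale scV (*)) (Qhat act om Bmu) \<O> (\<lambda>x. L (\<alpha> x))"
  proof (rule regular_onI)
    show "(\<lambda>x. 1 / 2 * (Qhat act om Bmu x * L (fst x, 0) + snd x * L (0, \<Psi> (fst x))))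
        \<in> poly_functions (pair_scale scV (*))"
      by (intro poly_functions_cmult poly_functions.add poly_functions.mult
          Qhat_poly snd_poly_Vhat fst \<Psi>)
    fix x assume x: "x \<in> \<O>"
    obtain P z where Pz: "x = (P, z)" by fastforce
    have z: "z \<noteq> 0" and Q: "Qhat act om Bmu x = lam * z\<^sup>2"
      using x by (auto simp: Pz mem_Ohat_iff Qhat_def)
    have "L (\<alpha> x) = L (scV (1 / 2) P, 0) + L (0, scV (1 / (2 * lam * z)) (\<Psi> P))"
      unfolding Pz alpha_eq[OF z] by (rule split(1))
    also have "\<dots> = 1 / 2 * L (P, 0) + 1 / (2 * lam * z) * L (0, \<Psi> P)"
      by (simp only: scale)
    \<comment> \<open>clearing the denominator: \<open>1 / 2\<lambda>z = z / 2Q\<close>\<close>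
    also have "\<dots> = 1 / 2 * (lam * z\<^sup>2 * L (P, 0) + z * L (0, \<Psi> P)) / (lam * z\<^sup>2) ^ 1"
      using z lam two by (simp add: power2_eq_square field_simps)
    finally show "L (\<alpha> x) = 1 / 2 * (Qhat act om Bmu x * L (fst x, 0) + snd x * L (0, \<Psi> (fst x)))
        / Qhat act om Bmu x ^ 1"
      unfolding Q by (simp only: Pz fst_conv snd_conv)
  qed
qed

lemma beta_pullback:
  assumes "f \<in> R_Ohat lam scV act om Bmu"
  shows "compose Z f \<beta> \<in> R_Zgen lam scM scV om Bmu"
  unfolding R_Zgen_def
proof (rule compose_in_restricted_ring)
  show "h \<in> poly_functions (pair_scale scV scV)" by (rule hform_poly)
  show "h v \<noteq> 0" if "v \<in> Z" for v using that by (simp add: Zgen_def)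
  show "\<beta> \<in> Z \<rightarrow> \<O>" using beta_in_Ohat by blast
  show "f \<in> restricted_ring (pair_scale scV (*)) (Qhat act om Bmu) \<O>"
    using assms by (simp add: R_Ohat_def)
  show "regular_on (pair_scale scV scV) h Z (\<lambda>v. 1 / Qhat act om Bmu (\<beta> v))"
  proof (rule regular_onI)
    show "(\<lambda>v. 1 / (lam * 3\<^sup>2)) \<in> poly_functions (pair_scale scV scV)"
      by (rule poly_functions.const)
    fix v assume "v \<in> Z"
    then have "Qhat act om Bmu (\<beta> v) = lam * (3 * h v)\<^sup>2"
      using beta_in_Ohat[of v] by (auto simp: Ohat_def Hhat_def beta_def)
    then show "1 / Qhat act om Bmu (\<beta> v) = 1 / (lam * 3\<^sup>2) / h v ^ 2"
      by (simp add: power_mult_distrib)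
  qed
next
  fix L assume L: "Vector_Spaces.linear (pair_scale scV (*)) (*) L"
  note split = linear_pair_split[OF L V.vector_space_axioms field_vector_space]
  have scale: "L (scV c A, 0) = c * L (A, 0)" "L (0, c * d) = d * L (0, c)" for c d A
    using split(2,3) by (simp_all add: Vector_Spaces.linear_iff mult.commute[of c d])
  have L_eq: "(\<lambda>v. L (\<beta> v)) = (\<lambda>v. 2 * L (fst v, 0) + L (0, 3) * h v)"
  proof
    fix v
    have "L (\<beta> v) = L (scV 2 (fst v), 0) + L (0, 6 * om (fst v) (snd v))"
      unfolding beta_eq by (rule split(1))
    also have "L (0, 6 * om (fst v) (snd v)) = L (0, 3) * (2 * om (fst v) (snd v))"
      using scale(2)[of 3 "2 * om (fst v) (snd v)"] by (simp add: mult.commute)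
    finally show "L (\<beta> v) = 2 * L (fst v, 0) + L (0, 3) * h v"
      by (simp only: hform_eq scale(1))
  qed
  show "regular_on (pair_scale scV scV) h Z (\<lambda>v. L (\<beta> v))"
    unfolding L_eq
    by (intro poly_regular_on poly_functions.add poly_functions_cmult hform_poly
        poly_functions.linear linear_comp[OF linear_fst split(2)] V.vector_space_axioms)
qed

end

lemma of_nat_prime_nonzero:
  assumes "prime p" "CHAR('k::field) \<noteq> p"
  shows "(of_nat p :: 'k) \<noteq> 0"
  using assms CHAR_not_1[where ?'a = 'k] by (auto simp: of_nat_eq_0_iff_char_dvd prime_nat_iff)

theorem theorem5p6:
  fixes scM :: "'k::field \<Rightarrow> 'm::ab_group_add \<Rightarrow> 'm"
    and brk :: "'m \<Rightarrow> 'm \<Rightarrow> 'm"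
    and scV :: "'k \<Rightarrow> 'v::ab_group_add \<Rightarrow> 'v"
    and act :: "'m \<Rightarrow> 'v \<Rightarrow> 'v"
    and om :: "'v \<Rightarrow> 'v \<Rightarrow> 'k"
    and Bmu :: "'v \<Rightarrow> 'v \<Rightarrow> 'm"
    and lam :: 'k
  assumes "CHAR('k) \<noteq> 2" and "CHAR('k) \<noteq> 3"
    and "special_symplectic_rep scM brk scV act om Bmu"
    and "lam \<noteq> 0"
  shows
    \<comment> \<open>(i)\<close>
    "(\<forall>Ph\<in>Ohat lam act om Bmu.
        alpha lam scV act Bmu (sigma Ph) = conj_lam (alpha lam scV act Bmu Ph)) \<and>
     \<comment> \<open>(ii)\<close>
     (\<forall>a. a \<noteq> 0 \<longrightarrow>
       (\<forall>Ph\<in>Ohat lam act om Bmu.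
          alpha lam scV act Bmu (act_Vhat scV a Ph) = pair_scale scV scV a (alpha lam scV act Bmu Ph)) \<and>
       (\<forall>v\<in>Zgen lam scM om Bmu.
          beta lam om (pair_scale scV scV a v) = act_Vhat scV a (beta lam om v))) \<and>
     \<comment> \<open>(iii)\<close>
     (alpha lam scV act Bmu \<in> Ohat lam act om Bmu \<rightarrow> Zgen lam scM om Bmu \<and>
      (\<forall>Ph\<in>Ohat lam act om Bmu. beta lam om (alpha lam scV act Bmu Ph) = Ph)) \<and>
     \<comment> \<open>(iv)\<close>
     (beta lam om \<in> Zgen lam scM om Bmu \<rightarrow> Ohat lam act om Bmu \<and>
      (\<forall>v\<in>Zgen lam scM om Bmu. alpha lam scV act Bmu (beta lam om v) = v)) \<and>
     \<comment> \<open>(v)\<close>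
     (\<lambda>f. compose (Ohat lam act om Bmu) f (alpha lam scV act Bmu))
        \<in> R_Zgen lam scM scV om Bmu \<rightarrow> R_Ohat lam scV act om Bmu \<and>
     \<comment> \<open>(vi)\<close>
     (\<lambda>f. compose (Zgen lam scM om Bmu) f (beta lam om))
        \<in> R_Ohat lam scV act om Bmu \<rightarrow> R_Zgen lam scM scV om Bmu"
proof -
  have "(2::'k) \<noteq> 0" "(3::'k) \<noteq> 0"
    using of_nat_prime_nonzero[of 2] of_nat_prime_nonzero[of 3] assms(1,2) by force+
  then interpret ssr_char_not_2_3 scM brk scV act om Bmu lam
    using assms(3,4) by (simp add: ssr_char_not_2_3_def ssr_char_not_2_3_axioms_def)
  show ?thesis
    by (intro conjI ballI allI impI Pi_I alpha_sigma alpha_act beta_act alpha_in_Zgen beta_alpha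
        beta_in_Ohat alpha_beta alpha_pullback beta_pullback)
qed

end
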